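(* Let $n,k$ be positive integers with $2\le k\le n-2$ and let $\alpha$ be a positive integer. Then $Q^*(C_n^k,\alpha\mathbf{1})$ is equal to the set of points $x\in\mathbb{R}^n$ satisfying $C_n^kx\ge\alpha\mathbf{1}$, $x\ge0$, the rank constraint $\sum_{j=1}^n x_j\ge\tau_{\alpha\mathbf{1}}(C_n^k)$, and the $\Gamma$-inequalities (with respect to $b=\alpha\mathbf{1}$) for the circuits $\Gamma$ of $F(C_n^k)$ containing no forward short arcs (and with $p(\Gamma)\ne 0$, so that the inequality is defined).
   Context: Notation: $[n]=\{1,\dots,n\}$ with addition mod $n$ (index $0$ identified with $n$); for $a,c\in[n]$ with $t\ge0$ minimal such that $a+t\equiv c\pmod n$, $[a,c)_n=\{a,\dots,a+t-1\}$ (mod $n$). $C_n^k$ is the $n\times n$ $\{0,1\}$-matrix whose row $i$ is the incidence vector of $[i,i+k)_n$. For a matrix $A$ and $b\in\mathbb{Z}_+^m$: $Q(A,b)=\{x\ge0:Ax\ge b\}$, $Q^*(A,b)=\operatorname{conv}(Q(A,b)\cap\mathbb{Z}^n)$, $\tau_b(A)=\min\{\mathbf{1}^Tx:x\in Q^*(A,b)\}$. For $A=C_n^k$ (so $\ell_i=i$, $k_i=k$), $F(A)$ is the digraph on $[n]$ (labels mod $n$) with forward row arcs $a_i=(i-1,i+k-1)$ ($i\in[n]$, length $k$), forward short arcs $(j-1,j)$ (length $1$) and reverse short arcs $(j,j-1)$ (length $-1$). A circuit is a simple directed circuit; winding number $p(\Gamma)$: $p(\Gamma)n=$ sum of lengths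 of arcs of $\Gamma$. For a circuit $\Gamma$ of $F(A)$ with $s$ row arcs and $p(\Gamma)\ne0$: $t=\alpha s$, $\beta=\lfloor t/p(\Gamma)\rfloor$, $r=t-\beta p(\Gamma)$, $\otimes(\Gamma)=\{j:(j,j-1)\in E(\Gamma)\}$, and the $\Gamma$-inequality is $\sum_{j\in[n]}[\delta_j+r]x_j\ge r(\beta+1)$ where $\delta_j=1$ if $j\in\otimes(\Gamma)$ and $0$ otherwise (this is the general circuit inequality $\sum_j[p^-(\Gamma,j)+r]x_j\ge r(\beta+1)+\sum_{i:\bar a_i\in E(\Gamma)}b_i$ specialized to circuits without reverse row arcs, $p^-(\Gamma,j)$ being the number of reverse arcs of $\Gamma$ jumping over $j$, and the reverse short arc $(j,j-1)$ jumping over $j$ only). *)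

theory Defs
  imports Complex_Main
begin

(* Vectors of R^n are represented as functions nat => real that vanish
   outside the index set [n] = {1..n}. *)

definition md :: "nat \<Rightarrow> int \<Rightarrow> int" where
  "md n a = (if a mod int n = 0 then int n else a mod int n)"

definition cint :: "nat \<Rightarrow> int \<Rightarrow> int \<Rightarrow> int set" where
  "cint n a c = (let t = (LEAST t::nat. (a + int t) mod int n = c mod int n)
                 in {md n (a + int s) | s. s < t})"

definition circ :: "nat \<Rightarrow> nat \<Rightarrow> nat \<Rightarrow> nat \<Rightarrow> real" where
  "circ n k i j = (if int j \<in> cint n (int i) (md n (int i + int k)) then 1 else 0)"

definition vecs :: "nat \<Rightarrow> (nat \<Rightarrow> real) set" where
  "vecs n = {x. \<forall>j. j \<notin> {1..n} \<longrightarrow> x j = 0}"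

definition Qpoly :: "nat \<Rightarrow> nat \<Rightarrow> (nat \<Rightarrow> nat \<Rightarrow> real) \<Rightarrow> (nat \<Rightarrow> real) \<Rightarrow> (nat \<Rightarrow> real) set" where
  "Qpoly m n A b = {x \<in> vecs n. (\<forall>j\<in>{1..n}. x j \<ge> 0) \<and>
                      (\<forall>i\<in>{1..m}. (\<Sum>j=1..n. A i j * x j) \<ge> b i)}"

definition conv :: "(nat \<Rightarrow> real) set \<Rightarrow> (nat \<Rightarrow> real) set" where
  "conv S = {x. \<exists>(p::nat) (mu::nat \<Rightarrow> real) v. (\<forall>i<p. mu i \<ge> 0 \<and> v i \<in> S) \<and>
                 (\<Sum>i<p. mu i) = 1 \<and> (\<forall>j. x j = (\<Sum>i<p. mu i * v i j))}"

definition Qstar :: "nat \<Rightarrow> nat \<Rightarrow> (nat \<Rightarrow> nat \<Rightarrow> real) \<Rightarrow> (nat \<Rightarrow> real) \<Rightarrow> (nat \<Rightarrow> real) set" where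
  "Qstar m n A b = conv {x \<in> Qpoly m n A b. \<forall>j. x j \<in> \<int>}"

definition tau :: "nat \<Rightarrow> nat \<Rightarrow> (nat \<Rightarrow> nat \<Rightarrow> real) \<Rightarrow> (nat \<Rightarrow> real) \<Rightarrow> real" where
  "tau m n A b = Inf {(\<Sum>j=1..n. x j) | x. x \<in> Qstar m n A b}"

datatype arc = RowArc int | FwdShort int | RevShort int

definition arcs :: "nat \<Rightarrow> arc set" where
  "arcs n = {RowArc i | i. i \<in> {1..int n}} \<union> {FwdShort j | j. j \<in> {1..int n}}
            \<union> {RevShort j | j. j \<in> {1..int n}}"

fun tl_arc :: "nat \<Rightarrow> nat \<Rightarrow> arc \<Rightarrow> int" where
  "tl_arc n k (RowArc i) = md n (i - 1)"
| "tl_arc n k (FwdShort j) = md n (j - 1)"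
| "tl_arc n k (RevShort j) = md n j"

fun hd_arc :: "nat \<Rightarrow> nat \<Rightarrow> arc \<Rightarrow> int" where
  "hd_arc n k (RowArc i) = md n (i + int k - 1)"
| "hd_arc n k (FwdShort j) = md n j"
| "hd_arc n k (RevShort j) = md n (j - 1)"

fun len_arc :: "nat \<Rightarrow> arc \<Rightarrow> int" where
  "len_arc k (RowArc i) = int k"
| "len_arc k (FwdShort j) = 1"
| "len_arc k (RevShort j) = -1"

definition is_row :: "arc \<Rightarrow> bool" where
  "is_row e = (case e of RowArc _ \<Rightarrow> True | _ \<Rightarrow> False)"

definition is_fwd :: "arc \<Rightarrow> bool" where
  "is_fwd e = (case e of FwdShort _ \<Rightarrow> True | _ \<Rightarrow> False)"

(* A simple directed circuit, given as the cyclic list of its arcs: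
   consecutive arcs are incident (cyclically) and the tails (= the vertices
   of the circuit) are pairwise distinct. *)
definition circuit :: "nat \<Rightarrow> nat \<Rightarrow> arc list \<Rightarrow> bool" where
  "circuit n k G = (G \<noteq> [] \<and> set G \<subseteq> arcs n \<and>
      (\<forall>i<length G. hd_arc n k (G ! i) = tl_arc n k (G ! ((i + 1) mod length G))) \<and>
      distinct (map (tl_arc n k) G))"

definition winding :: "nat \<Rightarrow> nat \<Rightarrow> arc list \<Rightarrow> int" where
  "winding n k G = (\<Sum>e\<leftarrow>G. len_arc k e) div int n"
  \<comment> \<open>p(Gamma): p n = sum of arc lengths (exact division for circuits)\<close>

definition nrows :: "arc list \<Rightarrow> nat" where
  "nrows G = length (filter is_row G)"

definition otimes :: "arc list \<Rightarrow> int set" where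
  "otimes G = {j. RevShort j \<in> set G}"

definition gamma_ineq :: "nat \<Rightarrow> nat \<Rightarrow> nat \<Rightarrow> arc list \<Rightarrow> (nat \<Rightarrow> real) \<Rightarrow> bool" where
  "gamma_ineq n k \<alpha> G x = (let p = winding n k G; t = int \<alpha> * int (nrows G);
       \<beta> = t div p; r = t - \<beta> * p in
     (\<Sum>j=1..n. (of_int ((if int j \<in> otimes G then 1 else 0) + r)) * x j) \<ge> of_int (r * (\<beta> + 1)))"

end

theory Submission
  imports Defs
begin

text \<open>
  Write a vector as the increments of a function w on the integers with w (j + n) = w j + X, where
  X is the coordinate sum; a row of the circulant system then reads w (i + k) - w i \<ge> \<alpha>.
  If X is an integer, all constraints are difference constraints with integral bounds, and cutting
  the fractional parts of w at a common threshold displays the vector as a convex combination of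
  integral points.

  If X = \<beta> + \<theta> with 0 < \<theta> < 1, we split w = v + (w - v), where v / (1 - \<theta>) is feasible with
  coordinate sum \<beta> and (w - v) / \<theta> is feasible with coordinate sum \<beta> + 1. The function v is a
  supremum of costs of walks that use only row arcs and reverse short arcs, and the circuit
  inequalities say that no circuit makes this supremum infinite. Forward short arcs are not needed
  because they commute with row arcs, all of which have the same cost, and cancel against reverse
  short arcs. The row constraints on w - v need no arcs of their own: they hold for the starting
  values, a multiple of w, and are preserved along every arc of a walk.
\<close>

section \<open>Vectors as increments of quasi-periodic functions\<close>

definition quasi_periodic :: "nat \<Rightarrow> real \<Rightarrow> (int \<Rightarrow> real) \<Rightarrow> bool" where
  "quasi_periodic n N U \<longleftrightarrow> (\<forall>j. U (j + int n) = U j + N)"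

text \<open>Coordinate \<open>j\<close> is the step of \<open>U\<close> from \<open>j - 1\<close> to
  \<open>j\<close>, so the row starting at \<open>i\<close> telescopes to the step of
  \<open>U\<close> along the row arc from \<open>i - 1\<close> to \<open>i + k - 1\<close>. The
  value 0 outside the index set keeps the result in \<open>vecs n\<close>.\<close>

definition increments :: "nat \<Rightarrow> (int \<Rightarrow> real) \<Rightarrow> nat \<Rightarrow> real" where
  "increments n U j = (if j \<in> {1..n} then U (int j) - U (int j - 1) else 0)"

lemma md_bounds: "0 < n \<Longrightarrow> 1 \<le> md n a \<and> md n a \<le> int n"
  unfolding md_def
  by (smt (verit) Euclidean_Rings.pos_mod_bound pos_mod_sign of_nat_0_less_iff)

lemma md_mod [simp]: "md n a mod int n = a mod int n"
  by (simp add: md_def)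

lemma md_eq_iff: "md n a = md n b \<longleftrightarrow> a mod int n = b mod int n"
  by (metis md_def md_mod)

lemma md_md_add [simp]: "md n (md n a + c) = md n (a + c)"
  by (simp add: md_eq_iff mod_add_left_eq[of "md n a", symmetric] mod_add_left_eq)

lemma md_md_diff [simp]: "md n (md n a - c) = md n (a - c)"
  using md_md_add[of n a "-c"] by simp

lemma md_md_add_diff [simp]: "md n (md n a + b - c) = md n (a + b - c)"
  using md_md_add[of n a "b-c"] by (simp add: algebra_simps)

lemma md_shift: obtains m where "md n a = a + m * int n"
proof -
  have "int n dvd md n a - a" by (simp add: mod_eq_dvd_iff[symmetric])
  then obtain m where "md n a - a = int n * m" by (elim dvdE)
  then have "md n a = a + m * int n" by (simp add: algebra_simps)
  then show thesis by (rule that)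
qed

lemma quasi_periodic_shift:
  assumes "quasi_periodic n N U"
  shows "U (j + m * int n) = U j + of_int m * N"
proof (induction m rule: int_induct[where k = 0])
  case (step1 i)
  then show ?case using assms[unfolded quasi_periodic_def, rule_format, of "j + i * int n"]
    by (simp add: algebra_simps)
next
  case (step2 i)
  then show ?case using assms[unfolded quasi_periodic_def, rule_format, of "j + (i - 1) * int n"]
    by (simp add: algebra_simps)
qed simp

lemma increments_md:
  assumes "0 < n" and "quasi_periodic n N U"
  shows "increments n U (nat (md n j)) = U j - U (j - 1)"
proof -
  obtain m where m: "md n j = j + m * int n" by (rule md_shift)
  have "increments n U (nat (md n j)) = U (md n j) - U (md n j - 1)"
    using md_bounds[OF assms(1), of j] by (auto simp: increments_def nat_le_iff)
  also have "md n j - 1 = (j - 1) + m * int n" using m by simp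
  finally show ?thesis using m by (simp add: quasi_periodic_shift[OF assms(2)])
qed

text \<open>No \<open>t < k\<close> qualifies, because \<open>k - t\<close> then lies strictly
  between 0 and \<open>n\<close> and is not divisible by \<open>n\<close>; for \<open>k = n\<close>
  the least \<open>t\<close> would be 0 and the interval empty.\<close>

lemma cint_eq:
  assumes "k < n"
  shows "cint n i (md n (i + int k)) = (\<lambda>s. md n (i + int s)) ` {..<k}"
proof -
  have "(LEAST t::nat. (i + int t) mod int n = md n (i + int k) mod int n) = k"
  proof (rule Least_equality)
    fix t assume "(i + int t) mod int n = md n (i + int k) mod int n"
    then have "int n dvd (i + int t) - (i + int k)" by (simp add: mod_eq_dvd_iff)
    then have "int n dvd int t - int k" by simp
    then have "int n dvd int k - int t" by (simp add: dvd_diff_commute)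
    then show "k \<le> t"
      using assms zdvd_imp_le[of "int n" "int k - int t"] by linarith
  qed simp
  then show ?thesis unfolding cint_def by auto
qed

lemma sum_increments_from:
  fixes U :: "int \<Rightarrow> real"
  shows "(\<Sum>s<m. U (i + int s) - U (i + int s - 1)) = U (i + int m - 1) - U (i - 1)"
proof (induction m)
  case (Suc m)
  have "i + int (Suc m) - 1 = i + int m" by simp
  then show ?case using Suc by (simp only: sum.lessThan_Suc)
qed simp

text \<open>As \<open>k < n\<close>, the residues met by a row are distinct, so the row sum
  reindexes to \<open>k\<close> consecutive steps of \<open>U\<close>, which telescope.\<close>

lemma row_sum_increments:
  assumes "k < n" and "quasi_periodic n N U"
  shows "(\<Sum>j=1..n. circ n k i j * increments n U j) = U (int i + int k - 1) - U (int i - 1)"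
proof -
  have n: "0 < n" using assms(1) by simp
  define S where "S = (\<lambda>s. nat (md n (int i + int s))) ` {..<k}"
  have inj: "inj_on (\<lambda>s. nat (md n (int i + int s))) {..<k}"
  proof (rule inj_onI)
    fix s t assume st: "s \<in> {..<k}" "t \<in> {..<k}"
      and "nat (md n (int i + int s)) = nat (md n (int i + int t))"
    then have "md n (int i + int s) = md n (int i + int t)"
      using md_bounds[OF n, of "int i + int s"] md_bounds[OF n, of "int i + int t"]
      by (simp add: eq_nat_nat_iff)
    then have "(int i + int s) mod int n = (int i + int t) mod int n" by (simp add: md_eq_iff)
    then have "int s mod int n = int t mod int n"
      by (simp add: mod_eq_dvd_iff)
    then show "s = t" using st assms(1) by simp
  qed
  have mem: "int j \<in> cint n (int i) (md n (int i + int k)) \<longleftrightarrow> j \<in> S" for j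
    unfolding cint_eq[OF assms(1)] S_def using md_bounds[OF n]
    by (smt (verit) image_iff int_nat_eq nat_int)
  have sub: "S \<subseteq> {1..n}"
    unfolding S_def using md_bounds[OF n] by (auto simp: nat_le_iff) (smt (verit) Suc_leI nat_0_iff zero_less_nat_eq)
  have "(\<Sum>j=1..n. circ n k i j * increments n U j) = (\<Sum>j=1..n. if j \<in> S then increments n U j else 0)"
    by (rule sum.cong) (auto simp: circ_def mem)
  also have "\<dots> = (\<Sum>j\<in>S. increments n U j)"
    using sub by (simp add: sum.inter_restrict[symmetric] Int_absorb1)
  also have "\<dots> = (\<Sum>s<k. increments n U (nat (md n (int i + int s))))"
    unfolding S_def by (simp add: sum.reindex[OF inj])
  also have "\<dots> = (\<Sum>s<k. U (int i + int s) - U (int i + int s - 1))"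
    by (simp add: increments_md[OF n assms(2)])
  also have "\<dots> = U (int i + int k - 1) - U (int i - 1)" by (rule sum_increments_from)
  finally show ?thesis .
qed

lemma total_increments:
  assumes "quasi_periodic n N U"
  shows "(\<Sum>j=1..n. increments n U j) = N"
proof -
  have "(\<Sum>j=1..n. increments n U j) = (\<Sum>s<n. U (1 + int s) - U (1 + int s - 1))"
    by (rule sum.reindex_bij_witness[of _ Suc "\<lambda>j. j - 1"]) (auto simp: increments_def of_nat_diff)
  also have "\<dots> = U (0 + int n) - U 0" unfolding sum_increments_from by simp
  finally show ?thesis using assms[unfolded quasi_periodic_def, rule_format, of 0] by simp
qed

lemma vecs_increments:
  assumes "0 < n" and "x \<in> vecs n"
  obtains w where "quasi_periodic n (\<Sum>j=1..n. x j) w" and "x = increments n w"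
proof -
  \<comment> \<open>Prefix sums within a period, plus one full total per completed period. At
    \<open>j = n\<close> the prefix is empty and the quotient 1 supplies the total.\<close>
  define w where "w j = of_int (j div int n) * (\<Sum>j=1..n. x j) + (\<Sum>i=1..nat (j mod int n). x i)" for j
  have "quasi_periodic n (\<Sum>j=1..n. x j) w"
    using assms(1) by (simp add: quasi_periodic_def w_def algebra_simps)
  moreover have "x j = increments n w j" for j
  proof (cases "j \<in> {1..n}")
    case False
    then show ?thesis using assms(2) by (auto simp: vecs_def increments_def)
  next
    case True
    then obtain i where i: "j = Suc i" "i < n" by (cases j) auto
    have wi: "w (int j - 1) = (\<Sum>i=1..i. x i)"
      using i by (simp add: w_def)
    have "w (int j) = (\<Sum>i=1..j. x i)"
      using True by (cases "j = n") (auto simp: w_def nat_mod_as_int[symmetric])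
    then show ?thesis using True wi i by (simp add: increments_def)
  qed
  ultimately show thesis using that by blast
qed

text \<open>Differences of \<open>U\<close> are invariant under shifts by \<open>n\<close>, so
  constraints with index in 1..n amount to constraints at all integers. The row with index congruent
  to \<open>i + 1\<close> bounds the step from \<open>i\<close> to \<open>i + k\<close>.\<close>

lemma increments_in_Qpoly_iff:
  assumes "k < n" and "quasi_periodic n N U"
  shows "increments n U \<in> Qpoly n n (circ n k) (\<lambda>_. c) \<longleftrightarrow>
    (\<forall>j. U (j - 1) \<le> U j) \<and> (\<forall>i. U i + c \<le> U (i + int k))"
proof -
  have n: "0 < n" using assms(1) by simp
  have "(\<forall>j\<in>{1..n}. increments n U j \<ge> 0) \<longleftrightarrow> (\<forall>j. U (j - 1) \<le> U j)"
  proof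
    assume *: "\<forall>j\<in>{1..n}. increments n U j \<ge> 0"
    show "\<forall>j. U (j - 1) \<le> U j"
    proof
      fix j
      have "nat (md n j) \<in> {1..n}" using md_bounds[OF n, of j] by auto
      then show "U (j - 1) \<le> U j" using * increments_md[OF n assms(2), of j] by fastforce
    qed
  qed (simp add: increments_def)
  moreover have "(\<forall>i\<in>{1..n}. (\<Sum>j=1..n. circ n k i j * increments n U j) \<ge> c)
      \<longleftrightarrow> (\<forall>i. U i + c \<le> U (i + int k))" (is "?L \<longleftrightarrow> ?R")
  proof
    assume *: ?L
    show ?R
    proof
      fix i
      obtain m where m: "md n (i + 1) = (i + 1) + m * int n" by (rule md_shift)
      have b: "nat (md n (i + 1)) \<in> {1..n}" "int (nat (md n (i + 1))) = md n (i + 1)"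
        using md_bounds[OF n, of "i + 1"] by auto
      have "c \<le> U (md n (i + 1) + int k - 1) - U (md n (i + 1) - 1)"
        using *[rule_format, OF b(1)] unfolding row_sum_increments[OF assms] b(2) .
      moreover have "md n (i + 1) + int k - 1 = (i + int k) + m * int n"
        "md n (i + 1) - 1 = i + m * int n" using m by simp_all
      ultimately show "U i + c \<le> U (i + int k)"
        by (simp add: quasi_periodic_shift[OF assms(2)])
    qed
  next
    assume *: ?R
    show ?L unfolding row_sum_increments[OF assms]
    proof
      fix i
      show "c \<le> U (int i + int k - 1) - U (int i - 1)"
        using *[rule_format, of "int i - 1"] by (simp add: algebra_simps)
    qed
  qed
  ultimately show ?thesis by (simp add: Qpoly_def vecs_def increments_def)
qed

section \<open>Convex hulls\<close>

lemma sum_lessThan_add: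
  fixes f :: "nat \<Rightarrow> real"
  shows "(\<Sum>i<p + q. f i) = (\<Sum>i<p. f i) + (\<Sum>i<q. f (p + i))"
  by (induction q) simp_all

lemma conv_convex:
  assumes "x \<in> conv S" and "y \<in> conv S" and "0 \<le> t" and "t \<le> 1"
  shows "(\<lambda>j. (1 - t) * x j + t * y j) \<in> conv S"
proof -
  obtain p :: nat and \<mu> v where x: "\<forall>i<p. \<mu> i \<ge> 0 \<and> v i \<in> S" "(\<Sum>i<p. \<mu> i) = 1"
    "\<forall>j. x j = (\<Sum>i<p. \<mu> i * v i j)"
    using assms(1) unfolding conv_def by blast
  obtain q :: nat and \<nu> u where y: "\<forall>i<q. \<nu> i \<ge> 0 \<and> u i \<in> S" "(\<Sum>i<q. \<nu> i) = 1"
    "\<forall>j. y j = (\<Sum>i<q. \<nu> i * u i j)"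
    using assms(2) unfolding conv_def by blast
  \<comment> \<open>The two combinations are concatenated, with weights scaled by
    \<open>1 - t\<close> and \<open>t\<close>.\<close>
  define \<rho> where "\<rho> i = (if i < p then (1 - t) * \<mu> i else t * \<nu> (i - p))" for i
  define z where "z i = (if i < p then v i else u (i - p))" for i
  have "\<rho> i \<ge> 0 \<and> z i \<in> S" if "i < p + q" for i
    using that x(1) y(1)[rule_format, of "i - p"] assms(3,4) by (auto simp: \<rho>_def z_def)
  moreover have "(\<Sum>i<p + q. \<rho> i) = 1"
    by (simp add: sum_lessThan_add \<rho>_def sum_distrib_left[symmetric] x(2) y(2))
  moreover have "(1 - t) * x j + t * y j = (\<Sum>i<p + q. \<rho> i * z i j)" for j
    by (simp add: sum_lessThan_add \<rho>_def z_def x(3) y(3) sum_distrib_left mult.assoc)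
  ultimately show ?thesis unfolding conv_def by blast
qed

lemma conv_ge:
  assumes "x \<in> conv S" and "\<And>v. v \<in> S \<Longrightarrow> b \<le> (\<Sum>j\<in>J. c j * v j)"
  shows "b \<le> (\<Sum>j\<in>J. c j * x j)"
proof -
  obtain p :: nat and \<mu> v where x: "\<forall>i<p. \<mu> i \<ge> 0 \<and> v i \<in> S" "(\<Sum>i<p. \<mu> i) = 1"
    "\<forall>j. x j = (\<Sum>i<p. \<mu> i * v i j)"
    using assms(1) unfolding conv_def by blast
  have "b = (\<Sum>i<p. \<mu> i * b)" using x(2) by (simp add: sum_distrib_right[symmetric])
  also have "\<dots> \<le> (\<Sum>i<p. \<mu> i * (\<Sum>j\<in>J. c j * v i j))"
    using x(1) assms(2) by (intro sum_mono mult_left_mono) auto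
  also have "\<dots> = (\<Sum>j\<in>J. c j * x j)"
    unfolding x(3)[rule_format] sum_distrib_left
    by (subst sum.swap) (simp add: mult.left_commute)
  finally show ?thesis .
qed

section \<open>Rounding when the coordinate sum is integral\<close>

text \<open>For 0 \<le> d < 1 this is the ceiling of \<open>t - d\<close>; averaging it over all
  such thresholds \<open>d\<close> gives back \<open>t\<close>.\<close>

definition round_at :: "real \<Rightarrow> real \<Rightarrow> real" where
  "round_at d t = of_int \<lfloor>t\<rfloor> + (if d < frac t then 1 else 0)"

lemma round_at_mono:
  assumes "s \<le> t" and "0 \<le> d"
  shows "round_at d s \<le> round_at d t"
proof (cases "\<lfloor>s\<rfloor> = \<lfloor>t\<rfloor>")
  case True
  then show ?thesis using assms by (auto simp: round_at_def frac_def)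
next
  case False
  then have "\<lfloor>s\<rfloor> + 1 \<le> \<lfloor>t\<rfloor>" using floor_mono[OF assms(1)] by simp
  then have "real_of_int \<lfloor>s\<rfloor> + 1 \<le> of_int \<lfloor>t\<rfloor>" by linarith
  then show ?thesis by (simp add: round_at_def)
qed

lemma round_at_add_int: "round_at d (t + of_int m) = round_at d t + of_int m"
  by (simp add: round_at_def frac_def)

lemma round_at_int: "round_at d t \<in> \<int>"
  by (simp add: round_at_def)

text \<open>Sorting the fractional parts of U as thresholds, the weight of each threshold is the gap to
  the next one.\<close>

lemma increments_in_Qstar:
  assumes "k < n" and U: "quasi_periodic n (of_int N) U"
    and mono: "\<And>j. U (j - 1) \<le> U j" and row: "\<And>i. U i + of_int c \<le> U (i + int k)"
  shows "increments n U \<in> Qstar n n (circ n k) (\<lambda>_. of_int c)"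
proof -
  \<comment> \<open>The endpoints 0 and 1 make the gaps sum to 1. Only the values of
    \<open>U\<close> on 0..n enter the increments.\<close>
  define D where "D = insert 0 (insert 1 ((\<lambda>j. frac (U j)) ` {0..int n}))"
  define ds where "ds = sorted_list_of_set D"
  define p where "p = length ds - 1"
  define \<mu> where "\<mu> i = ds ! (Suc i) - ds ! i" for i
  define v where "v i = increments n (\<lambda>j. round_at (ds ! i) (U j))" for i
  have fin: "finite D" by (simp add: D_def)
  then have set: "set ds = D" and sw: "sorted_wrt (<) ds" by (simp_all add: ds_def)
  have D01: "0 \<le> d" "d \<le> 1" if "d \<in> D" for d
    using that by (auto simp: D_def intro: less_imp_le[OF frac_lt_1])
  have len: "length ds = Suc p"
    using set D_def unfolding p_def by (cases ds) auto
  have less: "ds ! i < ds ! l \<longleftrightarrow> i < l" if "i < length ds" "l < length ds" for i l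
    using sw that by (metis linorder_neqE_nat not_less_iff_gr_or_eq sorted_wrt_nth_less)
  have nth: "ds ! i \<in> D" if "i \<le> p" for i using that len set nth_mem[of i ds] by simp
  have "0 \<in> set ds" "1 \<in> set ds" by (simp_all add: set D_def)
  then obtain l0 l1 where l: "l0 \<le> p" "ds ! l0 = 0" "l1 \<le> p" "ds ! l1 = 1"
    unfolding in_set_conv_nth len by (metis less_Suc_eq_le)
  have ds0: "ds ! 0 = 0"
    using less[of 0 l0] D01(1)[OF nth[of 0]] l len by (cases "l0 = 0") auto
  have dsp: "ds ! p = 1"
    using less[of l1 p] D01(2)[OF nth[of p]] l len by (cases "l1 = p") auto
  have \<mu>_sum: "(\<Sum>i<l. \<mu> i) = ds ! l" for l
    using sum_lessThan_telescope[of "\<lambda>i. ds ! i" l] ds0 by (simp add: \<mu>_def)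
  have repr: "(\<Sum>i<p. \<mu> i * round_at (ds ! i) (U j)) = U j" if j: "0 \<le> j" "j \<le> int n" for j
  proof -
    have "frac (U j) \<in> set ds" unfolding set D_def using j by simp
    then obtain l where l: "l \<le> p" "ds ! l = frac (U j)"
      unfolding in_set_conv_nth len by (metis less_Suc_eq_le)
    \<comment> \<open>The thresholds strictly below \<open>frac (U j) = ds ! l\<close> are those of
      index below \<open>l\<close>, and their gaps add up to \<open>ds ! l\<close>.\<close>
    have "(\<Sum>i<p. \<mu> i * round_at (ds ! i) (U j))
        = (\<Sum>i<p. \<mu> i * of_int \<lfloor>U j\<rfloor>) + (\<Sum>i<p. if i < l then \<mu> i else 0)"
      unfolding sum.distrib[symmetric] round_at_def l(2)[symmetric]
      using l(1) len by (intro sum.cong) (simp_all add: less algebra_simps)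
    also have "(\<Sum>i<p. if i < l then \<mu> i else 0) = (\<Sum>i<l. \<mu> i)"
      using l(1) by (intro sum.mono_neutral_cong_right) auto
    also have "(\<Sum>i<p. \<mu> i * of_int \<lfloor>U j\<rfloor>) = of_int \<lfloor>U j\<rfloor>"
      by (simp add: sum_distrib_right[symmetric] \<mu>_sum dsp)
    finally show ?thesis by (simp add: \<mu>_sum l(2) frac_def)
  qed
  have "\<mu> i \<ge> 0 \<and> v i \<in> {x \<in> Qpoly n n (circ n k) (\<lambda>_. of_int c). \<forall>j. x j \<in> \<int>}" if i: "i < p" for i
  proof (intro conjI CollectI)
    show "\<mu> i \<ge> 0" using less[of i "Suc i"] i len by (simp add: \<mu>_def)
    have di: "0 \<le> ds ! i" using nth D01 i by simp
    \<comment> \<open>Rounding is monotone and commutes with integer shifts, so constraints with the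
      integral constants \<open>N\<close> and \<open>c\<close> survive it.\<close>
    have qp: "quasi_periodic n (of_int N) (\<lambda>j. round_at (ds ! i) (U j))"
      using U by (simp add: quasi_periodic_def round_at_add_int)
    show "v i \<in> Qpoly n n (circ n k) (\<lambda>_. of_int c)"
      unfolding v_def increments_in_Qpoly_iff[OF assms(1) qp]
      using mono row round_at_mono[OF _ di] by (simp add: round_at_add_int[symmetric])
    show "\<forall>j. v i j \<in> \<int>" by (simp add: v_def increments_def round_at_int)
  qed
  moreover have "increments n U j = (\<Sum>i<p. \<mu> i * v i j)" for j
    by (cases "j \<in> {1..n}") (auto simp: v_def increments_def right_diff_distrib sum_subtractf repr)
  ultimately show ?thesis
    unfolding Qstar_def conv_def using \<mu>_sum[of p] dsp by auto
qed

section \<open>Costs along circuits and the covering inequality\<close>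

fun arc_gain :: "(int \<Rightarrow> real) \<Rightarrow> nat \<Rightarrow> arc \<Rightarrow> real" where
  "arc_gain w k (RowArc i) = w (i + int k - 1) - w (i - 1)"
| "arc_gain w k (FwdShort j) = w j - w (j - 1)"
| "arc_gain w k (RevShort j) = w (j - 1) - w j"

text \<open>Lower bounds for the steps of the function \<open>v\<close> to be built: at least
  \<open>a\<close> along a row arc, at least 0 along a forward short arc, and along a reverse short
  arc at least the (nonpositive) step of \<open>w\<close>.\<close>

fun arc_cost :: "(int \<Rightarrow> real) \<Rightarrow> real \<Rightarrow> arc \<Rightarrow> real" where
  "arc_cost w a (RowArc i) = a"
| "arc_cost w a (FwdShort j) = 0"
| "arc_cost w a (RevShort j) = w (j - 1) - w j"

definition rev_sum :: "nat \<Rightarrow> arc list \<Rightarrow> (nat \<Rightarrow> real) \<Rightarrow> real" where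
  "rev_sum n G x = (\<Sum>j=1..n. if int j \<in> otimes G then x j else 0)"

text \<open>On a circuit the list of heads is the list of tails rotated by one. A general group is
  used because \<open>f\<close> will be both the integer label and a real potential.\<close>

lemma circuit_telescope:
  fixes f :: "int \<Rightarrow> 'a::ab_group_add"
  assumes "circuit n k G"
  shows "(\<Sum>e\<leftarrow>G. f (hd_arc n k e) - f (tl_arc n k e)) = 0"
proof -
  have "map (hd_arc n k) G = rotate1 (map (tl_arc n k) G)"
    using assms by (intro nth_equalityI) (auto simp: circuit_def nth_rotate1)
  then have "map f (map (hd_arc n k) G) = rotate1 (map f (map (tl_arc n k) G))"
    by (simp only: rotate1_map)
  moreover have "sum_list (rotate1 ys) = sum_list ys" for ys :: "'a list"
    by (cases ys) (simp_all add: add.commute)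
  ultimately have "(\<Sum>e\<leftarrow>G. f (hd_arc n k e)) = (\<Sum>e\<leftarrow>G. f (tl_arc n k e))"
    by (simp add: comp_def)
  then show ?thesis by (simp add: sum_list_subtractf)
qed

text \<open>Each arc length is congruent modulo \<open>n\<close> to head minus tail, and these
  differences cancel around the circuit; hence the integer division in \<open>winding\<close> is
  exact.\<close>

lemma winding_times:
  assumes "circuit n k G"
  shows "winding n k G * int n = (\<Sum>e\<leftarrow>G. len_arc k e)"
proof -
  have "int n dvd len_arc k e - (hd_arc n k e - tl_arc n k e)" for e
  proof -
    have "hd_arc n k e = md n (tl_arc n k e + len_arc k e)"
      by (cases e) (simp_all add: diff_add_eq)
    then have "int n dvd (tl_arc n k e + len_arc k e) - hd_arc n k e"
      by (simp add: mod_eq_dvd_iff[symmetric])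
    then show ?thesis by (simp add: algebra_simps)
  qed
  then have "int n dvd (\<Sum>e\<leftarrow>G. len_arc k e - (hd_arc n k e - tl_arc n k e))"
    by (induction G) auto
  also have "\<dots> = (\<Sum>e\<leftarrow>G. len_arc k e)"
    using circuit_telescope[OF assms, of "\<lambda>i. i"] by (simp add: sum_list_subtractf)
  finally show ?thesis by (simp add: winding_def)
qed

text \<open>Subtracting the linear function of slope \<open>X / n\<close> makes \<open>w\<close>
  periodic, so the remainder depends on vertex labels only and telescopes. What is left is the slope
  times the total arc length.\<close>

lemma sum_arc_gain:
  assumes "0 < n" and "quasi_periodic n X w" and "circuit n k G"
  shows "(\<Sum>e\<leftarrow>G. arc_gain w k e) = of_int (winding n k G) * X"
proof -
  define \<phi> where "\<phi> j = w j - of_int j * (X / n)" for j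
  have \<phi>: "\<phi> (md n j) = \<phi> j" for j
  proof -
    obtain m where "md n j = j + m * int n" by (rule md_shift)
    then show ?thesis using assms(1)
      by (simp add: \<phi>_def quasi_periodic_shift[OF assms(2)] field_simps)
  qed
  have *: "arc_gain w k e = of_int (len_arc k e) * (X / n) + (\<phi> (hd_arc n k e) - \<phi> (tl_arc n k e))" for e
    by (cases e) (simp_all only: arc_gain.simps hd_arc.simps tl_arc.simps \<phi> len_arc.simps,
        simp_all add: \<phi>_def algebra_simps diff_divide_distrib)
  have "(\<Sum>e\<leftarrow>G. arc_gain w k e) = (\<Sum>e\<leftarrow>G. of_int (len_arc k e) * (X / n))"
    unfolding * sum_list_addf circuit_telescope[OF assms(3)] by simp
  also have "\<dots> = of_int (\<Sum>e\<leftarrow>G. len_arc k e) * (X / n)"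
    by (induction G) (simp_all add: add_divide_distrib distrib_right)
  also have "\<dots> = of_int (winding n k G) * X"
    using assms(1) by (simp flip: winding_times[OF assms(3)])
  finally show ?thesis .
qed

lemma sum_arc_cost:
  assumes "set G \<subseteq> arcs n" and "distinct G"
  shows "(\<Sum>e\<leftarrow>G. arc_cost w a e) = a * nrows G - rev_sum n G (increments n w)"
proof -
  define rv where "rv e = (case e of RevShort j \<Rightarrow> increments n w (nat j) | _ \<Rightarrow> 0)" for e
  have "(\<Sum>e\<leftarrow>G. arc_cost w a e) = a * nrows G - (\<Sum>e\<leftarrow>G. rv e)"
    using assms(1)
  proof (induction G)
    case (Cons e G)
    then show ?case
      by (cases e) (auto simp: nrows_def is_row_def rv_def arcs_def increments_def algebra_simps)
  qed (simp add: nrows_def)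
  also have "(\<Sum>e\<leftarrow>G. rv e) = (\<Sum>e\<in>set G. rv e)"
    using assms(2) by (simp add: sum_list_distinct_conv_sum_set)
  also have "\<dots> = (\<Sum>e\<in>(\<lambda>j. RevShort (int j)) ` {j \<in> {1..n}. int j \<in> otimes G}. rv e)"
  proof (rule sum.mono_neutral_right)
    show "\<forall>e\<in>set G - (\<lambda>j. RevShort (int j)) ` {j \<in> {1..n}. int j \<in> otimes G}. rv e = 0"
    proof
      fix e assume e: "e \<in> set G - (\<lambda>j. RevShort (int j)) ` {j \<in> {1..n}. int j \<in> otimes G}"
      show "rv e = 0"
      proof (cases e)
        case (RevShort j)
        then have "j \<in> {1..int n}" "j \<in> otimes G" using e assms(1) by (auto simp: arcs_def otimes_def)
        then have "e = RevShort (int (nat j))" "nat j \<in> {1..n}" "int (nat j) \<in> otimes G"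
          using RevShort by auto
        then show ?thesis using e by blast
      qed (simp_all add: rv_def)
    qed
  qed (auto simp: otimes_def)
  also have "\<dots> = (\<Sum>j\<in>{j \<in> {1..n}. int j \<in> otimes G}. increments n w j)"
    by (subst sum.reindex) (auto simp: inj_on_def rv_def)
  also have "\<dots> = rev_sum n G (increments n w)"
    unfolding rev_sum_def by (rule sum.inter_filter) simp
  finally show ?thesis .
qed

text \<open>Arcwise, cost is at most gain: on row arcs by the row constraints, on reverse short arcs
  with equality. The gains sum to the winding number times \<open>X\<close>.\<close>

lemma circuit_cover:
  assumes "k < n" and "quasi_periodic n X w" and "circuit n k G" and "\<not> (\<exists>e\<in>set G. is_fwd e)"
    and row: "\<And>i. w i + c \<le> w (i + int k)"
  shows "c * nrows G \<le> of_int (winding n k G) * X + rev_sum n G (increments n w)"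
proof -
  have "(\<Sum>e\<leftarrow>G. arc_cost w c e) \<le> (\<Sum>e\<leftarrow>G. arc_gain w k e)"
  proof (rule sum_list_mono)
    fix e assume "e \<in> set G"
    show "arc_cost w c e \<le> arc_gain w k e"
    proof (cases e)
      case (RowArc i)
      then show ?thesis using row[of "i - 1"] by (simp add: diff_add_eq)
    next
      case (FwdShort j)
      then show ?thesis using assms(4) \<open>e \<in> set G\<close> by (auto simp: is_fwd_def)
    qed simp
  qed
  moreover have "set G \<subseteq> arcs n" "distinct G"
    using assms(3) by (auto simp: circuit_def distinct_map)
  ultimately show ?thesis
    using assms(1) by (simp add: sum_arc_gain[OF _ assms(2,3)] sum_arc_cost)
qed

section \<open>Circuit inequalities at points with integral coordinate sum\<close>

lemma gamma_ineq_iff: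
  fixes p t :: int and n k \<alpha> :: nat and G :: "arc list"
  defines "p \<equiv> winding n k G" and "t \<equiv> int \<alpha> * int (nrows G)"
  shows "gamma_ineq n k \<alpha> G x \<longleftrightarrow>
    of_int (t mod p) * (of_int (t div p) + 1) \<le> rev_sum n G x + of_int (t mod p) * (\<Sum>j=1..n. x j)"
proof -
  have "(\<Sum>j=1..n. of_int ((if int j \<in> otimes G then 1 else 0) + r) * x j)
      = rev_sum n G x + of_int r * (\<Sum>j=1..n. x j)" for r :: int
    unfolding rev_sum_def sum_distrib_left sum.distrib[symmetric]
    by (intro sum.cong) (auto simp: algebra_simps)
  then show ?thesis
    unfolding gamma_ineq_def Let_def p_def t_def minus_div_mult_eq_mod by simp
qed

lemma tl_arc_range: "0 < n \<Longrightarrow> tl_arc n k e \<in> {1..int n}"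
  using md_bounds by (cases e) auto

lemma length_le_of_distinct_tails:
  assumes "0 < n" and "distinct (map (tl_arc n k) G)"
  shows "length G \<le> n"
proof -
  have "length G = card (set (map (tl_arc n k) G))"
    using distinct_card[OF assms(2)] by simp
  also have "\<dots> \<le> card {1..int n}"
    using tl_arc_range[OF assms(1)] by (intro card_mono) auto
  finally show ?thesis by simp
qed

text \<open>Row arcs have length at least 1 and all others at least -1, so the total is at least
  \<open>2 * nrows G - n\<close>; negative winding makes it at most \<open>-n\<close>.\<close>

lemma nrows_eq_0_if_winding_neg:
  assumes "0 < n" and "0 < k" and "circuit n k G" and "winding n k G < 0"
  shows "nrows G = 0"
proof -
  have "(\<Sum>e\<leftarrow>G. len_arc k e) \<ge> 2 * int (nrows G) - int (length G)"
  proof (induction G)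
    case (Cons e G)
    then show ?case using assms(2) by (cases e) (auto simp: nrows_def is_row_def)
  qed (simp add: nrows_def)
  moreover have "length G \<le> n"
    using length_le_of_distinct_tails[OF assms(1), of k G] assms(3) by (simp add: circuit_def)
  moreover have "(\<Sum>e\<leftarrow>G. len_arc k e) \<le> - int n"
    using winding_times[OF assms(3)] assms(1,4) mult_right_mono[of "winding n k G" "-1" "int n"] by simp
  ultimately show ?thesis by linarith
qed

text \<open>A mixed-integer rounding argument on the covering inequality
  \<open>t \<le> p * Z + R\<close>. If \<open>Z \<ge> b + 1\<close>, the term \<open>r * Z\<close>
  alone suffices. Otherwise \<open>b - Z\<close> is nonnegative, and its coefficient
  \<open>p\<close> in \<open>R \<ge> p * (b - Z) + r\<close> may be lowered to
  \<open>r\<close>.\<close>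

lemma gamma_ineq_of_integral:
  assumes "0 < k" and "k < n" and "quasi_periodic n X w" and "X \<in> \<int>"
    and "\<And>j. w (j - 1) \<le> w j" and "\<And>i. w i + real \<alpha> \<le> w (i + int k)"
    and "circuit n k G" and "\<not> (\<exists>e\<in>set G. is_fwd e)" and "winding n k G \<noteq> 0"
  shows "gamma_ineq n k \<alpha> G (increments n w)"
proof -
  define p t R where "p = winding n k G" and "t = int \<alpha> * int (nrows G)"
    and "R = rev_sum n G (increments n w)"
  have R0: "0 \<le> R"
    unfolding R_def rev_sum_def using assms(5) by (intro sum_nonneg) (auto simp: increments_def)
  obtain Z where Z: "X = of_int Z" using assms(4) by (elim Ints_cases)
  define b r where "b = t div p" and "r = t mod p"
  have "of_int r * (of_int b + 1) \<le> R + of_int r * X"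
  proof (cases "p < 0")
    case True
    \<comment> \<open>Without row arcs \<open>r = 0\<close>, and the claim reduces to
      \<open>0 \<le> R\<close>.\<close>
    then have "t = 0"
      using nrows_eq_0_if_winding_neg[of n k G] assms by (simp add: p_def t_def)
    then show ?thesis using R0 by (simp add: r_def)
  next
    case False
    then have p: "p > 0" using assms(9) by (simp add: p_def)
    have r: "0 \<le> r" "r \<le> p" using p by (simp_all add: r_def less_imp_le)
    have t: "t = p * b + r" by (simp add: b_def r_def)
    have cover: "of_int (p * b + r) \<le> of_int (p * Z) + R"
      using circuit_cover[OF assms(2,3,7,8,6)] unfolding R_def[symmetric] p_def[symmetric] Z t[symmetric] t_def
      by simp
    show ?thesis
    proof (cases "b + 1 \<le> Z")
      case True
      then have "r * (b + 1) \<le> r * Z" using r(1) by (rule mult_left_mono)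
      then have "real_of_int (r * (b + 1)) \<le> of_int (r * Z)" by (simp only: of_int_le_iff)
      then show ?thesis using R0 by (simp add: Z)
    next
      case False
      then have "r * (b - Z) \<le> p * (b - Z)" using r(2) by (intro mult_right_mono) auto
      then have "r * (b + 1) + p * Z \<le> p * b + r + r * Z" by (simp add: algebra_simps)
      then have "real_of_int (r * (b + 1) + p * Z) \<le> of_int (p * b + r + r * Z)"
        by (simp only: of_int_le_iff)
      then show ?thesis using cover by (simp add: Z)
    qed
  qed
  then show ?thesis
    unfolding gamma_ineq_iff total_increments[OF assms(3)] R_def r_def b_def t_def p_def .
qed

section \<open>Walks without forward short arcs\<close>

text \<open>With \<open>f\<close> the tail map on a walk, \<open>C\<close> is a simple circuit, and
  since \<open>e\<close> starts where \<open>C\<close> started, deleting \<open>C\<close> leaves a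
  walk. The induction from the right end meets the first repetition while the remaining list is
  still distinct.\<close>

lemma shortest_repetition:
  assumes "\<not> distinct (map f G)"
  obtains P C e Q where "G = P @ C @ e # Q" and "C \<noteq> []" and "distinct (map f C)"
    and "f (hd C) = f e"
  using assms
proof (induction G arbitrary: thesis)
  case (Cons g G)
  show ?case
  proof (cases "distinct (map f G)")
    case False
    then obtain P C e Q where "G = P @ C @ e # Q" "C \<noteq> []" "distinct (map f C)" "f (hd C) = f e"
      using Cons.IH by blast
    then show thesis using Cons.prems(1)[of "g # P" C e Q] by simp
  next
    case True
    then have "f g \<in> f ` set G" using Cons.prems(2) by simp
    then obtain e where e: "e \<in> set G" "f g = f e" by blast
    then obtain A Q where G: "G = A @ e # Q" by (meson split_list)
    then have "distinct (map f (g # A))" using True e(2) by auto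
    then show thesis using Cons.prems(1)[of "[]" "g # A" e Q] G e(2) by simp
  qed
qed simp

abbreviation "walk n k G \<equiv> set G \<subseteq> arcs n \<and> \<not> (\<exists>e\<in>set G. is_fwd e) \<and>
  successively (\<lambda>e e'. hd_arc n k e = tl_arc n k e') G"

lemma circuit_of_walk:
  assumes "walk n k G" and "G \<noteq> []" and "distinct (map (tl_arc n k) G)"
    and "hd_arc n k (last G) = tl_arc n k (hd G)"
  shows "circuit n k G"
  unfolding circuit_def
proof (intro conjI allI impI)
  fix i assume i: "i < length G"
  show "hd_arc n k (G ! i) = tl_arc n k (G ! ((i + 1) mod length G))"
  proof (cases "Suc i = length G")
    case True
    then have "i = length G - 1" by simp
    then show ?thesis using True assms(2,4) by (simp add: last_conv_nth hd_conv_nth)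
  next
    case False
    then show ?thesis using i assms(1) by (simp add: successively_conv_nth)
  qed
qed (use assms in auto)

text \<open>Reducing costs by \<open>B / n\<close> per unit of length makes every circuit
  nonpositive, so deleting circuits from a walk never lowers its reduced cost. What remains has
  distinct tails, hence at most \<open>n\<close> arcs.\<close>

lemma walk_cost_bounded:
  assumes "0 < n" and "\<And>j. w (j - 1) \<le> w j" and "0 \<le> a" and "0 \<le> B"
    and circ: "\<And>G. circuit n k G \<Longrightarrow> \<not> (\<exists>e\<in>set G. is_fwd e) \<Longrightarrow>
      (\<Sum>e\<leftarrow>G. arc_cost w a e) \<le> of_int (winding n k G) * B"
    and "walk n k G"
  shows "(\<Sum>e\<leftarrow>G. arc_cost w a e - of_int (len_arc k e) * (B / n)) \<le> n * (a + B / n)"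
  using assms(6)
proof (induction "length G" arbitrary: G rule: less_induct)
  case less
  let ?c = "\<lambda>e. arc_cost w a e - of_int (len_arc k e) * (B / n)"
  have Bn: "0 \<le> B / n" using assms(4) by simp
  show ?case
  proof (cases "distinct (map (tl_arc n k) G)")
    case True
    \<comment> \<open>The summand \<open>B / n\<close> covers reverse short arcs, whose length is
      -1.\<close>
    have "?c e \<le> a + B / n" if "e \<in> set G" for e
      using Bn assms(2)[of "case e of RevShort j \<Rightarrow> j | _ \<Rightarrow> 0"] assms(3,4)
      by (cases e) (simp_all add: algebra_simps)
    then have "(\<Sum>e\<leftarrow>G. ?c e) \<le> (\<Sum>e\<leftarrow>G. a + B / n)" by (rule sum_list_mono)
    also have "\<dots> = length G * (a + B / n)" by (simp add: sum_list_triv)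
    also have "\<dots> \<le> n * (a + B / n)"
      using length_le_of_distinct_tails[OF assms(1) True] assms(3) Bn by (intro mult_right_mono) auto
    finally show ?thesis .
  next
    case False
    then obtain P C e Q where G: "G = P @ C @ e # Q" "C \<noteq> []" "distinct (map (tl_arc n k) C)"
      "tl_arc n k (hd C) = tl_arc n k e" by (rule shortest_repetition)
    have C: "circuit n k C"
      using less.prems G by (intro circuit_of_walk) (auto simp: successively_append_iff)
    have "walk n k (P @ e # Q)"
      using less.prems G(2,4) unfolding G(1) by (auto simp: successively_append_iff successively_Cons)
    moreover have "length (P @ e # Q) < length G" using G(1,2) by simp
    ultimately have "(\<Sum>e\<leftarrow>P @ e # Q. ?c e) \<le> n * (a + B / n)" using less.hyps by blast
    moreover have "(\<Sum>e\<leftarrow>C. ?c e) \<le> 0"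
    proof -
      have "(\<Sum>e\<leftarrow>C. of_int (len_arc k e) * (B / n)) = of_int (\<Sum>e\<leftarrow>C. len_arc k e) * (B / n)"
        by (induction C) (simp_all add: add_divide_distrib distrib_right)
      also have "\<dots> = of_int (winding n k C) * B"
        using assms(1) by (simp flip: winding_times[OF C])
      finally show ?thesis
        using circ[OF C] less.prems G(1) by (auto simp: sum_list_subtractf)
    qed
    ultimately show ?thesis unfolding G(1) by simp
  qed
qed

section \<open>The supremum of walk costs as a potential\<close>

text \<open>\<open>c\<close> is a starting value of \<open>u\<close> plus the cost of a walk ending
  at \<open>j\<close>. Walks live on the integers, the universal cover of the cyclic vertex set, so
  that their suprema form a function on the integers.\<close>

inductive reach :: "(int \<Rightarrow> real) \<Rightarrow> (int \<Rightarrow> real) \<Rightarrow> nat \<Rightarrow> real \<Rightarrow> int \<Rightarrow> real \<Rightarrow> bool"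
  for u w k a where
  start: "reach u w k a j (u j)"
| row: "reach u w k a i c \<Longrightarrow> reach u w k a (i + int k) (c + a)"
| rev: "reach u w k a j c \<Longrightarrow> reach u w k a (j - 1) (c + (w (j - 1) - w j))"

text \<open>Projection of the integer walk to vertex labels; quasi-periodicity of \<open>w\<close>
  keeps the costs. The head condition spares the empty list, to which any first arc may be
  appended.\<close>

lemma reach_walk:
  assumes "0 < n" and w: "quasi_periodic n X w" and "reach u w k a j c"
  shows "\<exists>i G. walk n k G \<and> (G \<noteq> [] \<longrightarrow> hd_arc n k (last G) = md n j) \<and>
    j = i + (\<Sum>e\<leftarrow>G. len_arc k e) \<and> c = u i + (\<Sum>e\<leftarrow>G. arc_cost w a e)"
  using assms(3)
proof induction
  case (start j)
  show ?case by (rule exI[of _ j], rule exI[of _ "[]"]) simp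
next
  case (row j c)
  then obtain i G where G: "walk n k G" "G \<noteq> [] \<longrightarrow> hd_arc n k (last G) = md n j"
    "j = i + (\<Sum>e\<leftarrow>G. len_arc k e)" "c = u i + (\<Sum>e\<leftarrow>G. arc_cost w a e)" by blast
  let ?e = "RowArc (md n (j + 1))"
  have "?e \<in> arcs n" using md_bounds[OF assms(1)] by (auto simp: arcs_def)
  then have "walk n k (G @ [?e])" using G(1,2)
    by (auto simp: successively_append_iff is_fwd_def)
  moreover have "hd_arc n k ?e = md n (j + int k)" by simp
  ultimately show ?case using G(3,4)
    by (intro exI[of _ i] exI[of _ "G @ [?e]"]) simp
next
  case (rev j c)
  then obtain i G where G: "walk n k G" "G \<noteq> [] \<longrightarrow> hd_arc n k (last G) = md n j"
    "j = i + (\<Sum>e\<leftarrow>G. len_arc k e)" "c = u i + (\<Sum>e\<leftarrow>G. arc_cost w a e)" by blast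
  let ?e = "RevShort (md n j)"
  obtain m where m: "md n j = j + m * int n" by (rule md_shift)
  have "j + m * int n - 1 = (j - 1) + m * int n" by simp
  then have cost: "arc_cost w a ?e = w (j - 1) - w j"
    unfolding arc_cost.simps m by (simp only: quasi_periodic_shift[OF w])
  have "?e \<in> arcs n" using md_bounds[OF assms(1)] by (auto simp: arcs_def)
  then have "walk n k (G @ [?e])" using G(1,2) md_md_add[of n j 0]
    by (auto simp: successively_append_iff is_fwd_def)
  moreover have "hd_arc n k ?e = md n (j - 1)" by simp
  ultimately show ?case using G(3,4) cost
    by (intro exI[of _ i] exI[of _ "G @ [?e]"]) (simp del: arc_cost.simps)
qed

text \<open>Relative to slope \<open>B / n\<close>, the starting values are periodic, hence bounded
  by their maximum over one period, and the walk costs are bounded by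
  \<open>walk_cost_bounded\<close>.\<close>

lemma reach_bounded:
  assumes "0 < n" and w: "quasi_periodic n X w" and u: "quasi_periodic n B u"
    and "\<And>j. w (j - 1) \<le> w j" and "0 \<le> a" and "0 \<le> B"
    and "\<And>G. circuit n k G \<Longrightarrow> \<not> (\<exists>e\<in>set G. is_fwd e) \<Longrightarrow>
      (\<Sum>e\<leftarrow>G. arc_cost w a e) \<le> of_int (winding n k G) * B"
  shows "\<exists>K. \<forall>j c. reach u w k a j c \<longrightarrow> c \<le> of_int j * (B / n) + K"
proof -
  define \<phi> where "\<phi> j = u j - of_int j * (B / n)" for j
  have \<phi>: "\<phi> (md n j) = \<phi> j" for j
  proof -
    obtain m where "md n j = j + m * int n" by (rule md_shift)
    then show ?thesis using assms(1)
      by (simp add: \<phi>_def quasi_periodic_shift[OF u] field_simps)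
  qed
  define M where "M = Max (\<phi> ` {1..int n})"
  have M: "\<phi> j \<le> M" for j
    unfolding M_def \<phi>[of j, symmetric] using md_bounds[OF assms(1), of j] by (intro Max_ge) auto
  have "c \<le> of_int j * (B / n) + (M + n * (a + B / n))" if r: "reach u w k a j c" for j c
  proof -
    obtain i G where G: "walk n k G" "j = i + (\<Sum>e\<leftarrow>G. len_arc k e)"
      "c = u i + (\<Sum>e\<leftarrow>G. arc_cost w a e)" using reach_walk[OF assms(1) w r] by blast
    have "(\<Sum>e\<leftarrow>G. arc_cost w a e - of_int (len_arc k e) * (B / n)) \<le> n * (a + B / n)"
      by (rule walk_cost_bounded[OF assms(1,4-7) G(1)])
    moreover have "(\<Sum>e\<leftarrow>G. arc_cost w a e - of_int (len_arc k e) * (B / n))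
        = (\<Sum>e\<leftarrow>G. arc_cost w a e) - of_int (\<Sum>e\<leftarrow>G. len_arc k e) * (B / n)"
      by (induction G) (simp_all add: add_divide_distrib distrib_right)
    moreover have "of_int j * (B / n) = of_int i * (B / n) + of_int (\<Sum>e\<leftarrow>G. len_arc k e) * (B / n)"
      unfolding G(2) by (simp add: add_divide_distrib distrib_right)
    ultimately show ?thesis using M[of i] G(3) unfolding \<phi>_def by linarith
  qed
  then show ?thesis by blast
qed

text \<open>Properties of the supremum \<open>v\<close> come from closure properties of
  \<open>reach\<close>: appending a row or reverse short arc bounds \<open>v\<close> from below at
  the new end, and translating walks by \<open>n\<close> gives quasi-periodicity. The upper bound on
  row steps is an invariant of walks.\<close>

lemma potential_exists:
  assumes "0 < n" and w: "quasi_periodic n X w" and u: "quasi_periodic n B u"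
    and wmono: "\<And>j. w (j - 1) \<le> w j" and umono: "\<And>j. u (j - 1) \<le> u j"
    and "0 \<le> a" and "0 \<le> B"
    and wrow: "\<And>i. w i + (a + d) \<le> w (i + int k)"
    and urow: "\<And>i. u (i + int k) - u i \<le> w (i + int k) - w i - d"
    and "\<And>G. circuit n k G \<Longrightarrow> \<not> (\<exists>e\<in>set G. is_fwd e) \<Longrightarrow>
      (\<Sum>e\<leftarrow>G. arc_cost w a e) \<le> of_int (winding n k G) * B"
  obtains v where "quasi_periodic n B v" and "\<And>j. v (j - 1) \<le> v j"
    and "\<And>j. v j - v (j - 1) \<le> w j - w (j - 1)"
    and "\<And>i. v i + a \<le> v (i + int k)" and "\<And>i. v (i + int k) - v i \<le> w (i + int k) - w i - d"
proof -
  let ?r = "reach u w k a"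
  define v where "v j = Sup {c. ?r j c}" for j
  obtain K where K: "\<And>j c. ?r j c \<Longrightarrow> c \<le> of_int j * (B / n) + K"
    using reach_bounded[OF assms(1-4,6,7,10)] by blast
  have le: "c \<le> v j" if "?r j c" for j c
    unfolding v_def using K that by (intro cSup_upper) (auto simp: bdd_above_def)
  have least: "v j \<le> y" if "\<And>c. ?r j c \<Longrightarrow> c \<le> y" for j y
    unfolding v_def using that reach.start[of u w k a j] by (intro cSup_least) auto
  have shift: "?r (j + m * int n) (c + of_int m * B)" if "?r j c" for j c m
    using that
  proof induction
    case (start j)
    show ?case using reach.start[of u w k a "j + m * int n"] by (simp add: quasi_periodic_shift[OF u])
  next
    case (row i c)
    from reach.row[OF row.IH] show ?case by (simp add: algebra_simps)
  next
    case (rev j c)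
    have "j + m * int n - 1 = (j - 1) + m * int n" by simp
    then have "w (j + m * int n - 1) - w (j + m * int n) = w (j - 1) - w j"
      by (simp only: quasi_periodic_shift[OF w])
    with reach.rev[OF rev.IH] show ?case by (simp add: algebra_simps)
  qed
  have "v (j + int n) = v j + B" for j
  proof (rule antisym)
    show "v (j + int n) \<le> v j + B"
    proof (rule least)
      fix c assume "?r (j + int n) c"
      from le[OF shift[OF this, of "-1"]] show "c \<le> v j + B" by simp
    qed
    have "v j \<le> v (j + int n) - B"
    proof (rule least)
      fix c assume "?r j c"
      from le[OF shift[OF this, of 1]] show "c \<le> v (j + int n) - B" by simp
    qed
    then show "v j + B \<le> v (j + int n)" by simp
  qed
  then have v: "quasi_periodic n B v" by (simp add: quasi_periodic_def)
  \<comment> \<open>A forward short arc appended to a walk can be moved to its front or cancelled.\<close>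
  have up: "\<exists>c'. ?r (j + 1) c' \<and> c \<le> c'" if "?r j c" for j c
    using that
  proof induction
    case (start j)
    show ?case using reach.start[of u w k a "j + 1"] umono[of "j + 1"] by auto
  next
    case (row i c)
    then obtain c' where "?r (i + 1) c'" "c \<le> c'" by blast
    then show ?case using reach.row[of u w k a "i + 1" c']
      by (intro exI[of _ "c' + a"]) (simp add: algebra_simps)
  next
    case (rev j c)
    then show ?case using wmono[of j] by (intro exI[of _ c]) simp
  qed
  have vmono: "v (j - 1) \<le> v j" for j
    using up[of "j - 1"] le by (intro least) force
  have vrev: "v j - v (j - 1) \<le> w j - w (j - 1)" for j
  proof -
    have "v j \<le> v (j - 1) + (w j - w (j - 1))"
    proof (rule least)
      fix c assume "?r j c"
      from le[OF reach.rev[OF this]] show "c \<le> v (j - 1) + (w j - w (j - 1))" by simp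
    qed
    then show ?thesis by simp
  qed
  have vrow: "v i + a \<le> v (i + int k)" for i
  proof -
    have "v i \<le> v (i + int k) - a"
    proof (rule least)
      fix c assume "?r i c"
      from le[OF reach.row[OF this]] show "c \<le> v (i + int k) - a" by simp
    qed
    then show ?thesis by simp
  qed
  \<comment> \<open>Starting values satisfy this by \<open>urow\<close>. After a row arc from
    \<open>i\<close>, use \<open>c \<le> v i\<close> and the slack \<open>a + d\<close> in
    \<open>wrow\<close>; after a reverse short arc, apply \<open>vrev\<close> at the position
    \<open>k\<close> lower.\<close>
  have "c \<le> v (j - int k) + (w j - w (j - int k) - d)" if "?r j c" for j c
    using that
  proof induction
    case (start j)
    show ?case using urow[of "j - int k"] le[OF reach.start[of u w k a "j - int k"]] by simp
  next
    case (row i c)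
    then show ?case using le[OF row.hyps] wrow[of i] by simp
  next
    case (rev j c)
    have "j - 1 - int k = j - int k - 1" by simp
    then show ?case using rev.IH vrev[of "j - int k"] by (simp only:)
  qed
  then have "v j \<le> v (j - int k) + (w j - w (j - int k) - d)" for j by (intro least) blast
  from this[of "_ + int k"] have "v (i + int k) - v i \<le> w (i + int k) - w i - d" for i
    by (simp add: algebra_simps)
  then show thesis using that v vmono vrev vrow by blast
qed

section \<open>Splitting a point with fractional coordinate sum\<close>

text \<open>The circuit inequality is needed only if \<alpha> s div p = \<beta>; otherwise summing the row constraints
  along the circuit suffices.\<close>

lemma circuit_cost_le:
  assumes "k < n" and "quasi_periodic n X w"
    and mono: "\<And>j. w (j - 1) \<le> w j" and row: "\<And>i. w i + real \<alpha> \<le> w (i + int k)"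
    and G: "circuit n k G" "\<not> (\<exists>e\<in>set G. is_fwd e)"
    and gamma: "winding n k G \<noteq> 0 \<Longrightarrow> gamma_ineq n k \<alpha> G (increments n w)"
    and X: "X = of_int \<beta> + \<theta>" "0 \<le> \<beta>" "0 \<le> \<theta>" "\<theta> < 1"
  shows "(\<Sum>e\<leftarrow>G. arc_cost w ((1 - \<theta>) * \<alpha>) e) \<le> of_int (winding n k G) * ((1 - \<theta>) * of_int \<beta>)"
proof -
  define p t R where "p = winding n k G" and "t = int \<alpha> * int (nrows G)"
    and "R = rev_sum n G (increments n w)"
  have R0: "0 \<le> R"
    unfolding R_def rev_sum_def using mono by (intro sum_nonneg) (auto simp: increments_def)
  have t0: "0 \<le> t" by (simp add: t_def)
  have cover: "of_int t \<le> of_int p * X + R"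
    using circuit_cover[OF assms(1,2) G row] by (simp add: t_def p_def R_def)
  have "(1 - \<theta>) * of_int t - R \<le> of_int p * ((1 - \<theta>) * of_int \<beta>)"
  proof (cases "p \<le> 0")
    case True
    have "(1 - \<theta>) * of_int t - R \<le> of_int t - R"
      using mult_right_mono[of "1 - \<theta>" 1 "of_int t"] X(3) t0 by simp
    also have "\<dots> \<le> of_int p * X" using cover by simp
    \<comment> \<open>\<open>X\<close> is at least \<open>(1 - \<theta>) * \<beta>\<close>, and the
      factor \<open>p \<le> 0\<close> reverses the order.\<close>
    also have "\<dots> \<le> of_int p * ((1 - \<theta>) * of_int \<beta>)"
      using True X by (intro mult_left_mono_neg) (simp_all add: algebra_simps)
    finally show ?thesis .
  next
    case False
    define b r where "b = t div p" and "r = t mod p"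
    have r: "0 \<le> r" "r < p" using False by (simp_all add: r_def)
    have t: "t = p * b + r" by (simp add: b_def r_def)
    consider "b + 1 \<le> \<beta>" | "b = \<beta>" | "\<beta> + 1 \<le> b" by linarith
    then show ?thesis
    proof cases
      case 1
      \<comment> \<open>Here \<open>t \<le> p * \<beta>\<close>, so the bound holds even without
        subtracting \<open>R\<close>.\<close>
      have "t \<le> p * (b + 1)" using r t by (simp add: algebra_simps)
      also have "\<dots> \<le> p * \<beta>" using 1 False by (intro mult_left_mono) auto
      finally have "real_of_int t \<le> of_int p * of_int \<beta>" by (simp flip: of_int_mult)
      then have "(1 - \<theta>) * of_int t \<le> (1 - \<theta>) * (of_int p * of_int \<beta>)"
        using X(4) by (intro mult_left_mono) auto
      then show ?thesis using R0 by (simp add: algebra_simps)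
    next
      case 2
      \<comment> \<open>With \<open>X = \<beta> + \<theta>\<close> the circuit inequality becomes
        \<open>(1 - \<theta>) * r \<le> R\<close>, exactly the excess over
        \<open>p * \<beta>\<close> to be absorbed.\<close>
      have "of_int r * (of_int b + 1) \<le> R + of_int r * X"
        using gamma False
        unfolding gamma_ineq_iff total_increments[OF assms(2)] R_def r_def b_def t_def p_def by simp
      then have "(1 - \<theta>) * of_int r \<le> R" unfolding X(1) 2 by (simp add: algebra_simps)
      then show ?thesis unfolding t 2 by (simp add: algebra_simps)
    next
      case 3
      \<comment> \<open>Subtracting \<open>\<theta> * t \<ge> \<theta> * p * (\<beta> + 1)\<close>
        from the covering inequality leaves \<open>p * (1 - \<theta>) * \<beta>\<close> on the
        right.\<close>
      have "p * (\<beta> + 1) \<le> p * b" using 3 False by (intro mult_left_mono) auto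
      also have "\<dots> \<le> t" using r t by simp
      finally have "real_of_int p * (of_int \<beta> + 1) \<le> of_int t"
        by (metis of_int_1 of_int_add of_int_le_iff of_int_mult)
      then have "\<theta> * (of_int p * (of_int \<beta> + 1)) \<le> \<theta> * of_int t"
        using X(3) by (intro mult_left_mono)
      then show ?thesis using cover unfolding X(1) by (simp add: algebra_simps)
    qed
  qed
  moreover have "set G \<subseteq> arcs n" "distinct G"
    using G(1) by (auto simp: circuit_def distinct_map)
  ultimately show ?thesis
    by (simp add: sum_arc_cost t_def p_def R_def mult.assoc)
qed

lemma increments_in_Qstar_if_gamma:
  assumes "k < n" and w: "quasi_periodic n X w"
    and mono: "\<And>j. w (j - 1) \<le> w j" and row: "\<And>i. w i + real \<alpha> \<le> w (i + int k)"
    and gamma: "\<And>G. circuit n k G \<Longrightarrow> \<not> (\<exists>e\<in>set G. is_fwd e) \<Longrightarrow> winding n k G \<noteq> 0 \<Longrightarrow>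
      gamma_ineq n k \<alpha> G (increments n w)"
  shows "increments n w \<in> Qstar n n (circ n k) (\<lambda>_. real \<alpha>)"
proof (cases "X \<in> \<int>")
  case True
  then obtain N where "X = of_int N" by (elim Ints_cases)
  then show ?thesis using increments_in_Qstar[of k n N w "int \<alpha>"] assms by simp
next
  case False
  define \<beta> \<theta> where "\<beta> = \<lfloor>X\<rfloor>" and "\<theta> = frac X"
  have \<theta>: "0 < \<theta>" "\<theta> < 1" using False by (simp_all add: \<theta>_def frac_lt_1)
  have X: "X = of_int \<beta> + \<theta>" by (simp add: \<beta>_def \<theta>_def frac_def)
  have "0 \<le> X"
    unfolding total_increments[OF w, symmetric]
    using mono by (intro sum_nonneg) (simp add: increments_def)
  then have \<beta>0: "0 \<le> \<beta>" by (simp add: \<beta>_def)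
  have X0: "0 < X" using X \<beta>0 \<theta>(1) by linarith
  \<comment> \<open>With this period increment for \<open>v\<close>,
    \<open>v / (1 - \<theta>)\<close> has coordinate sum \<open>\<beta>\<close>, and
    \<open>X - B = \<theta> * (\<beta> + 1)\<close> gives \<open>(w - v) / \<theta>\<close> the sum
    \<open>\<beta> + 1\<close>.\<close>
  define B where "B = (1 - \<theta>) * of_int \<beta>"
  have B0: "0 \<le> B" using \<beta>0 \<theta> by (simp add: B_def)
  have BX: "\<theta> \<le> 1 - B / X"
  proof -
    have "B \<le> (1 - \<theta>) * X" unfolding B_def X using \<theta> by (intro mult_left_mono) auto
    then show ?thesis using X0 by (simp add: field_simps)
  qed
  \<comment> \<open>Rescaling \<open>w\<close> to total \<open>B\<close> leaves the share
    \<open>1 - B / X \<ge> \<theta>\<close> of each row for \<open>w - u\<close>, which is the upper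
    row bound required of starting values.\<close>
  define u where "u j = w j * (B / X)" for j
  have u: "quasi_periodic n B u"
    using w X0 by (simp add: quasi_periodic_def u_def field_simps)
  have umono: "u (j - 1) \<le> u j" for j
    unfolding u_def using mono B0 X0 by (intro mult_right_mono) auto
  have urow: "u (i + int k) - u i \<le> w (i + int k) - w i - \<theta> * \<alpha>" for i
  proof -
    have "\<theta> * \<alpha> \<le> (1 - B / X) * (w (i + int k) - w i)"
      using BX row[of i] \<theta> by (intro mult_mono) auto
    then show ?thesis by (simp add: u_def algebra_simps)
  qed
  have wrow: "w i + ((1 - \<theta>) * \<alpha> + \<theta> * \<alpha>) \<le> w (i + int k)" for i
    using row[of i] by (simp add: algebra_simps)
  have cost: "(\<Sum>e\<leftarrow>G. arc_cost w ((1 - \<theta>) * \<alpha>) e) \<le> of_int (winding n k G) * B"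
    if "circuit n k G" "\<not> (\<exists>e\<in>set G. is_fwd e)" for G
    unfolding B_def using circuit_cost_le[OF assms(1) w mono row that gamma[OF that] X \<beta>0] \<theta> by simp
  obtain v where v: "quasi_periodic n B v" "\<And>j. v (j - 1) \<le> v j"
    "\<And>j. v j - v (j - 1) \<le> w j - w (j - 1)" "\<And>i. v i + (1 - \<theta>) * \<alpha> \<le> v (i + int k)"
    "\<And>i. v (i + int k) - v i \<le> w (i + int k) - w i - \<theta> * \<alpha>"
    using potential_exists[OF _ w u mono umono _ B0 wrow urow cost] assms(1) \<theta> by auto
  have "increments n (\<lambda>j. v j / (1 - \<theta>)) \<in> Qstar n n (circ n k) (\<lambda>_. of_int (int \<alpha>))"
  proof (rule increments_in_Qstar[OF assms(1)])
    show "quasi_periodic n (of_int \<beta>) (\<lambda>j. v j / (1 - \<theta>))"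
      using v(1) \<theta> by (simp add: quasi_periodic_def B_def add_divide_distrib)
    show "v (j - 1) / (1 - \<theta>) \<le> v j / (1 - \<theta>)" for j
      using v(2) \<theta> by (intro divide_right_mono) auto
    show "v i / (1 - \<theta>) + of_int (int \<alpha>) \<le> v (i + int k) / (1 - \<theta>)" for i
      using divide_right_mono[OF v(4)[of i], of "1 - \<theta>"] \<theta> by (simp add: add_divide_distrib)
  qed
  moreover have "increments n (\<lambda>j. (w j - v j) / \<theta>) \<in> Qstar n n (circ n k) (\<lambda>_. of_int (int \<alpha>))"
  proof (rule increments_in_Qstar[OF assms(1)])
    show "quasi_periodic n (of_int (\<beta> + 1)) (\<lambda>j. (w j - v j) / \<theta>)"
      using v(1) w \<theta> by (simp add: quasi_periodic_def B_def X field_simps)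
    show "(w (j - 1) - v (j - 1)) / \<theta> \<le> (w j - v j) / \<theta>" for j
      using v(3)[of j] \<theta> by (intro divide_right_mono) auto
    show "(w i - v i) / \<theta> + of_int (int \<alpha>) \<le> (w (i + int k) - v (i + int k)) / \<theta>" for i
    proof -
      have "w i - v i + \<theta> * \<alpha> \<le> w (i + int k) - v (i + int k)" using v(5)[of i] by simp
      from divide_right_mono[OF this, of \<theta>] show ?thesis using \<theta> by (simp add: add_divide_distrib)
    qed
  qed
  ultimately have "(\<lambda>j. (1 - \<theta>) * increments n (\<lambda>j. v j / (1 - \<theta>)) j
      + \<theta> * increments n (\<lambda>j. (w j - v j) / \<theta>) j) \<in> Qstar n n (circ n k) (\<lambda>_. of_int (int \<alpha>))"
    unfolding Qstar_def using \<theta> by (intro conv_convex) auto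
  moreover have "(1 - \<theta>) * increments n (\<lambda>j. v j / (1 - \<theta>)) j
      + \<theta> * increments n (\<lambda>j. (w j - v j) / \<theta>) j = increments n w j" for j
    using \<theta> by (simp add: increments_def right_diff_distrib diff_divide_distrib)
  ultimately show ?thesis by simp
qed

section \<open>Equality of the integer hull and the inequality system\<close>

theorem theorem6p4:
  fixes n k \<alpha> :: nat
  assumes "2 \<le> k" and "k + 2 \<le> n" and "0 < \<alpha>"
  shows "Qstar n n (circ n k) (\<lambda>_. real \<alpha>) =
    {x \<in> vecs n.
       (\<forall>i\<in>{1..n}. (\<Sum>j=1..n. circ n k i j * x j) \<ge> real \<alpha>) \<and>
       (\<forall>j\<in>{1..n}. x j \<ge> 0) \<and>
       (\<Sum>j=1..n. x j) \<ge> tau n n (circ n k) (\<lambda>_. real \<alpha>) \<and>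
       (\<forall>G. circuit n k G \<and> \<not> (\<exists>e\<in>set G. is_fwd e) \<and> winding n k G \<noteq> 0
              \<longrightarrow> gamma_ineq n k \<alpha> G x)}"
  (is "?Q = ?R")
proof (intro equalityI subsetI)
  have kn: "0 < k" "k < n" "0 < n" using assms by auto
  let ?S = "{x \<in> Qpoly n n (circ n k) (\<lambda>_. real \<alpha>). \<forall>j. x j \<in> \<int>}"
  {
    fix x assume x: "x \<in> ?R"
    obtain w where w: "quasi_periodic n (\<Sum>j=1..n. x j) w" "x = increments n w"
      using vecs_increments[OF kn(3)] x by blast
    have "increments n w \<in> Qpoly n n (circ n k) (\<lambda>_. real \<alpha>)"
      using x unfolding w(2)[symmetric] Qpoly_def by blast
    then have "\<And>j. w (j - 1) \<le> w j" "\<And>i. w i + real \<alpha> \<le> w (i + int k)"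
      unfolding increments_in_Qpoly_iff[OF kn(2) w(1)] by auto
    then show "x \<in> ?Q"
      using increments_in_Qstar_if_gamma[OF kn(2) w(1)] x unfolding w(2)[symmetric] by blast
  next
    fix x assume Q: "x \<in> ?Q"
    then have x: "x \<in> conv ?S" by (simp add: Qstar_def)
    have nonneg: "0 \<le> y j" if y: "y \<in> ?Q" and j: "j \<in> {1..n}" for y j
    proof -
      have "0 \<le> (\<Sum>i\<in>{j}. 1 * y i)"
        using y j unfolding Qstar_def by (elim conv_ge) (auto simp: Qpoly_def)
      then show ?thesis by simp
    qed
    have "x \<in> vecs n"
    proof -
      obtain p :: nat and \<mu> v where "\<forall>i<p. \<mu> i \<ge> 0 \<and> v i \<in> ?S" "\<forall>j. x j = (\<Sum>i<p. \<mu> i * v i j)"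
        using x unfolding conv_def by blast
      then show ?thesis by (auto simp: vecs_def Qpoly_def)
    qed
    moreover have "real \<alpha> \<le> (\<Sum>j=1..n. circ n k i j * x j)" if "i \<in> {1..n}" for i
      using x that by (elim conv_ge) (auto simp: Qpoly_def)
    moreover have "tau n n (circ n k) (\<lambda>_. real \<alpha>) \<le> (\<Sum>j=1..n. x j)"
      unfolding tau_def
    proof (rule cInf_lower)
      \<comment> \<open>The real \<open>Inf\<close> is a lower bound once the set is bounded below,
        here by 0.\<close>
      show "bdd_below {(\<Sum>j=1..n. x j) | x. x \<in> ?Q}"
        using nonneg by (intro bdd_belowI[of _ 0]) (auto intro!: sum_nonneg)
    qed (use Q in blast)
    \<comment> \<open>The inequality is linear in \<open>x\<close>, so it passes to the hull from
      integral points, whose coordinate sums are integers.\<close>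
    moreover have "gamma_ineq n k \<alpha> G x"
      if G: "circuit n k G" "\<not> (\<exists>e\<in>set G. is_fwd e)" "winding n k G \<noteq> 0" for G
      unfolding gamma_ineq_def Let_def
    proof (rule conv_ge[OF x])
      fix y assume y: "y \<in> ?S"
      obtain w where w: "quasi_periodic n (\<Sum>j=1..n. y j) w" "y = increments n w"
        using vecs_increments[OF kn(3)] y by (auto simp: Qpoly_def)
      have "increments n w \<in> Qpoly n n (circ n k) (\<lambda>_. real \<alpha>)"
        using y unfolding w(2)[symmetric] by blast
      then have "\<And>j. w (j - 1) \<le> w j" "\<And>i. w i + real \<alpha> \<le> w (i + int k)"
        unfolding increments_in_Qpoly_iff[OF kn(2) w(1)] by auto
      moreover have "(\<Sum>j=1..n. y j) \<in> \<int>" using y by (intro Ints_sum) auto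
      ultimately have "gamma_ineq n k \<alpha> G y"
        using gamma_ineq_of_integral[OF kn(1,2) w(1) _ _ _ G] unfolding w(2)[symmetric] by blast
      then show "of_int ((int \<alpha> * int (nrows G) - int \<alpha> * int (nrows G) div winding n k G * winding n k G)
          * (int \<alpha> * int (nrows G) div winding n k G + 1))
        \<le> (\<Sum>j=1..n. of_int ((if int j \<in> otimes G then 1 else 0) +
            (int \<alpha> * int (nrows G) - int \<alpha> * int (nrows G) div winding n k G * winding n k G)) * y j)"
        unfolding gamma_ineq_def Let_def .
    qed
    ultimately show "x \<in> ?R" using nonneg[OF Q] by blast
  }
qed

end
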